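(* Let $A\in\mathbb{R}^{n_x\times n_x}$, $B\in\mathbb{R}^{n_x\times n_u}$, $C\in\mathbb{R}^{n_y\times n_x}$ and $D\in\mathbb{R}^{n_y\times n_u}$. Let $0<\mu_u\le\nu_u$ and $0<\mu_y\le\nu_y$, and set $\alpha_u=\frac{\nu_u+\mu_u}{2}$, $\beta_u=\frac{\nu_u-\mu_u}{2}$, $\alpha_y=\frac{\nu_y+\mu_y}{2}$, $\beta_y=\frac{\nu_y-\mu_y}{2}$. Suppose the following two LMIs are feasible. (a) There exist a symmetric $P\succ0$, $Y\in\mathbb{R}^{n_x\times n_x}$, $X\in\mathbb{R}^{n_u\times n_x}$, $\sigma>0$ and $\rho_c\in(0,1)$ with $$\begin{bmatrix}(1-\rho_c)P-\sigma BB^\mathsf{T} & AY+\alpha_uBX & 0\\ \star & Y^\mathsf{T}+Y-P & \beta_uX^\mathsf{T}\\ \star&\star&\sigma I\end{bmatrix}\succ0.$$ Set $K=XY^{-1}$. (b) There exist a symmetric $Q\succ0$, $U\in\mathbb{R}^{n_x\times n_x}$, $V\in\mathbb{R}^{n_x\times n_y}$, $\eta>0$ and $\rho_o\in(0,1)$ with $$\begin{bmatrix}(1-\rho_o)Q-\eta C^\mathsf{T}C & (UA+\alpha_yVC)^\mathsf{T} & 0\\ \star & U+U^\mathsf{T}-Q & \beta_yV\\ \star&\star&\eta I\end{bmatrix}\succ0.$$ Set $L=U^{-1}V$. Let $\mathcal{S}_u:\mathbb{R}^{n_u}\to\mathbb{R}^{n_u}$ be continuously differentiable with $\mathcal{S}_u(0)=0$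 and $\|\mathcal{J}^u(v)-\alpha_uI\|\le\beta_u$ for all $v$. Let $\mathcal{S}_y:\mathbb{R}^{n_y}\to\mathbb{R}^{n_y}$ be continuously differentiable with $\|\mathcal{J}^y(z)-\alpha_yI\|\le\beta_y$ for all $z$. Consider the closed-loop system $$x_{k+1}=Ax_k+B\mathcal{S}_u(u_k),\quad \hat x_{k+1}=A\hat x_k+B\mathcal{S}_u(u_k)+L(\hat y_k-y_k),$$ $$y_k=\mathcal{S}_y(Cx_k+D\mathcal{S}_u(u_k)),\quad \hat y_k=\mathcal{S}_y(C\hat x_k+D\mathcal{S}_u(u_k)),\quad u_k=K\hat x_k.$$ Then this closed-loop system is globally exponentially stable. That is, there exist constants $c>0$ and $\lambda\in(0,1)$ such that for all initial conditions $x_0,\hat x_0$ and all $k\ge0$, $$\|x_k\|+\|\hat x_k-x_k\|\le c\,\lambda^k\big(\|x_0\|+\|\hat x_0-x_0\|\big).$$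
   Context: $\|\cdot\|$ denotes the Euclidean norm and the induced spectral matrix norm. $M\succ0$ means $M$ is symmetric positive definite, and $\star$ denotes the blocks determined by symmetry. $\mathcal{J}^u$ and $\mathcal{J}^y$ denote the Jacobians of $\mathcal{S}_u$ and $\mathcal{S}_y$. The Jacobian conditions are the uncertainty-set description the paper uses for bi-Lipschitz scaffolding nonlinearities; in the scalar case they are equivalent to the derivative lying in $[\mu,\nu]$. *)

theory Defs
  imports "HOL-Analysis.Analysis"
begin

text \<open>Symmetric positive definite matrix: M = M^T and v^T M v > 0 for all v \<noteq> 0.\<close>
definition pos_def :: "real^'n^'n \<Rightarrow> bool" where
  "pos_def M \<longleftrightarrow> transpose M = M \<and> (\<forall>v. v \<noteq> 0 \<longrightarrow> v \<bullet> (M *v v) > 0)"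

text \<open>Symmetric 3x3 block matrix
  [M11 M12 M13; M12^T M22 M23; M13^T M23^T M33], indexed by 'a + ('b + 'c).\<close>
definition blk3 ::
  "real^'a^'a \<Rightarrow> real^'b^'a \<Rightarrow> real^'c^'a \<Rightarrow> real^'b^'b \<Rightarrow> real^'c^'b \<Rightarrow> real^'c^'c
   \<Rightarrow> real^('a + ('b + 'c))^('a + ('b + 'c))" where
  "blk3 M11 M12 M13 M22 M23 M33 = (\<chi> i j.
     (case i of
        Inl a \<Rightarrow> (case j of Inl a' \<Rightarrow> M11 $ a $ a'
                          | Inr (Inl b') \<Rightarrow> M12 $ a $ b'
                          | Inr (Inr c') \<Rightarrow> M13 $ a $ c')
      | Inr (Inl b) \<Rightarrow> (case j of Inl a' \<Rightarrow> M12 $ a' $ b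
                          | Inr (Inl b') \<Rightarrow> M22 $ b $ b'
                          | Inr (Inr c') \<Rightarrow> M23 $ b $ c')
      | Inr (Inr c) \<Rightarrow> (case j of Inl a' \<Rightarrow> M13 $ a' $ c
                          | Inr (Inl b') \<Rightarrow> M23 $ b' $ c
                          | Inr (Inr c') \<Rightarrow> M33 $ c $ c')))"

text \<open>Spectral (operator) norm of a matrix.\<close>
definition spec_norm :: "real^'n^'m \<Rightarrow> real" where
  "spec_norm M = onorm (\<lambda>v. M *v v)"

end

theory Submission
  imports Defs
begin

(* Both LMIs are dissipation inequalities. Evaluated at (e, -e', z), with z the normalised
   sector-bounded part of the output nonlinearity, the observer LMI shows that e.Qe contracts by
   1 - rho_o along the estimation error e = xh - x, whatever the input. The controller LMI is the
   observer LMI of the dual system (A', B', Y', X'); a Cauchy-Schwarz argument in the P-metric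
   turns the dual contraction into contraction by 1 - rho_c of x.P^-1 x along the nominal loop
   x -> Ax + B Su(Kx). The applied input Su(K xh) differs from Su(Kx) by O(|e|), so by Young's
   inequality x.P^-1 x contracts by 1 - rho_c/2 up to a term c |e|^2, and a suitably weighted sum
   of the two quadratic forms decays geometrically. *)

lemma inner_vector_matrix: "(x::real^'n) \<bullet> (y v* M) = y \<bullet> (M *v x)"
  by (metis dot_lmul_matrix inner_commute)

lemma inner_symmetric_matrix:
  "transpose M = M \<Longrightarrow> u \<bullet> ((M::real^'n^'n) *v v) = v \<bullet> (M *v u)"
  by (metis inner_vector_matrix transpose_matrix_vector)

lemma matrix_vector_mult_uminus: "(M::real^'n^'m) *v (- x) = - (M *v x)"
  by (simp add: matrix_vector_mult_def vec_eq_iff sum_negf)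

lemma norm_matrix_vector_le_spec_norm: "norm ((M::real^'n^'m) *v v) \<le> spec_norm M * norm v"
  unfolding spec_norm_def by (rule onorm[OF matrix_vector_mul_bounded_linear])

lemma spec_norm_nonneg: "0 \<le> spec_norm (M::real^'n^'m)"
  unfolding spec_norm_def by (rule onorm_pos_le[OF matrix_vector_mul_bounded_linear])

lemma quadratic_form_le_spec_norm: "v \<bullet> ((M::real^'n^'n) *v v) \<le> spec_norm M * (norm v)\<^sup>2"
proof -
  have "v \<bullet> (M *v v) \<le> norm v * norm (M *v v)"
    by (rule Cauchy_Schwarz_ineq2[THEN abs_le_D1])
  also have "\<dots> \<le> norm v * (spec_norm M * norm v)"
    by (simp add: mult_left_mono norm_matrix_vector_le_spec_norm)
  finally show ?thesis by (simp add: power2_eq_square algebra_simps)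
qed

lemma matrix_inv_inverse:
  fixes M :: "real^'n^'n"
  assumes "invertible M"
  shows "M ** matrix_inv M = mat 1" and "matrix_inv M ** M = mat 1"
proof -
  obtain M' where "M ** M' = mat 1 \<and> M' ** M = mat 1"
    using assms unfolding invertible_def by blast
  then have "M ** matrix_inv M = mat 1 \<and> matrix_inv M ** M = mat 1"
    unfolding matrix_inv_def by (rule someI)
  then show "M ** matrix_inv M = mat 1" "matrix_inv M ** M = mat 1" by blast+
qed

lemma invertible_if_kernel_trivial:
  fixes M :: "real^'n^'n"
  assumes "\<And>v. M *v v = 0 \<Longrightarrow> v = 0"
  shows "invertible M"
  using assms by (simp add: invertible_left_inverse matrix_left_invertible_ker)

lemma pos_def_nonneg: "pos_def M \<Longrightarrow> 0 \<le> v \<bullet> (M *v v)"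
  unfolding pos_def_def by (cases "v = 0") (auto intro: less_imp_le)

lemma pos_def_invertible: "pos_def M \<Longrightarrow> invertible M"
  by (rule invertible_if_kernel_trivial) (force simp: pos_def_def)

lemma pos_def_matrix_inv:
  fixes M :: "real^'n^'n"
  assumes M: "pos_def M"
  shows "pos_def (matrix_inv M)"
proof -
  let ?W = "matrix_inv M"
  have MW: "M ** ?W = mat 1"
    using matrix_inv_inverse[OF pos_def_invertible[OF M]] by blast
  have sym: "transpose M = M" using M by (simp add: pos_def_def)
  have "transpose ?W ** M = mat 1"
    by (metis MW sym matrix_transpose_mul transpose_mat)
  then have "transpose ?W = ?W"
    by (metis MW matrix_mul_assoc matrix_mul_lid matrix_mul_rid)
  moreover have "0 < v \<bullet> (?W *v v)" if "v \<noteq> 0" for v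
  proof -
    have "v = M *v (?W *v v)" by (simp add: matrix_vector_mul_assoc MW)
    then have "?W *v v \<noteq> 0" using that by auto
    then have "0 < (?W *v v) \<bullet> (M *v (?W *v v))" using M by (simp add: pos_def_def)
    also have "\<dots> = v \<bullet> (?W *v v)" by (simp add: matrix_vector_mul_assoc MW inner_commute)
    finally show ?thesis .
  qed
  ultimately show ?thesis unfolding pos_def_def by blast
qed

lemma pos_def_coercive:
  fixes M :: "real^'n^'n"
  assumes "pos_def M"
  obtains m where "0 < m" and "\<And>v. m * (norm v)\<^sup>2 \<le> v \<bullet> (M *v v)"
proof -
  have cont: "continuous_on (sphere 0 1) (\<lambda>v::real^'n. v \<bullet> (M *v v))"
    by (intro continuous_intros linear_continuous_on) auto
  have "sphere (0::real^'n) 1 \<noteq> {}"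
    using norm_axis_1[of undefined] by (metis empty_iff mem_sphere_0)
  then obtain v0 where v0: "v0 \<in> sphere 0 1"
    and min: "\<And>u. u \<in> sphere 0 1 \<Longrightarrow> v0 \<bullet> (M *v v0) \<le> u \<bullet> (M *v u)"
    using continuous_attains_inf[OF compact_sphere _ cont] by blast
  have pos: "0 < v0 \<bullet> (M *v v0)"
    using v0 assms unfolding pos_def_def by (metis mem_sphere_0 norm_zero zero_neq_one)
  have "v0 \<bullet> (M *v v0) * (norm v)\<^sup>2 \<le> v \<bullet> (M *v v)" for v
  proof (cases "v = 0")
    case False
    define u where "u = (1 / norm v) *\<^sub>R v"
    have "u \<in> sphere 0 1" using False by (simp add: u_def)
    then have "v0 \<bullet> (M *v v0) \<le> u \<bullet> (M *v u)" by (rule min)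
    moreover have "v \<bullet> (M *v v) = (norm v)\<^sup>2 * (u \<bullet> (M *v u))"
      using False by (simp add: u_def matrix_vector_mult_scaleR power2_eq_square)
    ultimately show ?thesis by (simp add: mult_right_mono mult.commute)
  qed simp
  with pos show thesis by (rule that)
qed

lemma pos_def_cauchy_schwarz:
  fixes M :: "real^'n^'n"
  assumes M: "pos_def M"
  shows "(u \<bullet> (M *v v))\<^sup>2 \<le> (u \<bullet> (M *v u)) * (v \<bullet> (M *v v))"
proof (cases "u = 0")
  case False
  define a where "a = u \<bullet> (M *v v)"
  define b where "b = u \<bullet> (M *v u)"
  have b: "0 < b" using M False by (simp add: pos_def_def b_def)
  have sym: "v \<bullet> (M *v u) = a"
    using M by (simp add: a_def pos_def_def inner_symmetric_matrix)
  have "0 \<le> ((a / b) *\<^sub>R u - v) \<bullet> (M *v ((a / b) *\<^sub>R u - v))"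
    by (rule pos_def_nonneg[OF M])
  also have "\<dots> = v \<bullet> (M *v v) - a\<^sup>2 / b"
    using b sym by (simp add: a_def[symmetric] b_def[symmetric] matrix_vector_mult_diff_distrib
        matrix_vector_mult_scaleR inner_diff_left inner_diff_right power2_eq_square field_simps)
  finally show ?thesis using b by (simp add: a_def[symmetric] b_def[symmetric] field_simps)
qed simp

lemma quadratic_form_young:
  fixes M :: "real^'n^'n"
  assumes M: "pos_def M" and "0 < \<epsilon>"
  shows "(u + v) \<bullet> (M *v (u + v)) \<le> (1 + \<epsilon>) * (u \<bullet> (M *v u)) + (1 + 1 / \<epsilon>) * (v \<bullet> (M *v v))"
proof -
  have sym: "v \<bullet> (M *v u) = u \<bullet> (M *v v)"
    using M by (simp add: pos_def_def inner_symmetric_matrix)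
  have "0 \<le> (\<epsilon> *\<^sub>R u - v) \<bullet> (M *v (\<epsilon> *\<^sub>R u - v))" by (rule pos_def_nonneg[OF M])
  also have "\<dots> = \<epsilon>\<^sup>2 * (u \<bullet> (M *v u)) - 2 * \<epsilon> * (u \<bullet> (M *v v)) + v \<bullet> (M *v v)"
    using sym by (simp add: power2_eq_square algebra_simps)
  finally have "2 * (u \<bullet> (M *v v)) \<le> \<epsilon> * (u \<bullet> (M *v u)) + (1 / \<epsilon>) * (v \<bullet> (M *v v))"
    using \<open>0 < \<epsilon>\<close> by (simp add: power2_eq_square field_simps)
  moreover have "(u + v) \<bullet> (M *v (u + v)) = u \<bullet> (M *v u) + 2 * (u \<bullet> (M *v v)) + v \<bullet> (M *v v)"
    using sym by (simp add: matrix_vector_right_distrib inner_add_left inner_add_right)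
  ultimately show ?thesis by (simp add: algebra_simps)
qed

definition vec3 :: "real^'a \<Rightarrow> real^'b \<Rightarrow> real^'c \<Rightarrow> real^('a + ('b + 'c))" where
  "vec3 p q z = (\<chi> i. case i of Inl a \<Rightarrow> p $ a | Inr (Inl b) \<Rightarrow> q $ b | Inr (Inr c) \<Rightarrow> z $ c)"

lemma sum_UNIV_Plus:
  "sum f (UNIV :: ('a::finite + 'b::finite) set) = sum (\<lambda>a. f (Inl a)) UNIV + sum (\<lambda>b. f (Inr b)) UNIV"
  using sum.Plus[of "UNIV::'a set" "UNIV::'b set" f] by (simp add: o_def)

lemma vec3_eq_0_iff: "vec3 p q z = 0 \<longleftrightarrow> p = 0 \<and> q = 0 \<and> z = 0"
  unfolding vec3_def vec_eq_iff by (auto split: sum.split)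

lemma quadratic_form_blk3:
  "vec3 p q z \<bullet> (blk3 M11 M12 M13 M22 M23 M33 *v vec3 p q z) =
     p \<bullet> (M11 *v p) + 2 * (p \<bullet> (M12 *v q)) + 2 * (p \<bullet> (M13 *v z))
     + q \<bullet> (M22 *v q) + 2 * (q \<bullet> (M23 *v z)) + z \<bullet> (M33 *v z)"
proof -
  have "vec3 p q z \<bullet> (blk3 M11 M12 M13 M22 M23 M33 *v vec3 p q z) =
      p \<bullet> (M11 *v p + M12 *v q + M13 *v z) + q \<bullet> (transpose M12 *v p + M22 *v q + M23 *v z)
      + z \<bullet> (transpose M13 *v p + transpose M23 *v q + M33 *v z)"
    by (simp add: vec3_def blk3_def inner_vec_def matrix_vector_mult_def sum_UNIV_Plus transpose_def
        sum.distrib algebra_simps)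
  then show ?thesis by (simp add: inner_add_right inner_vector_matrix)
qed

lemma pos_def_blk3_middle:
  assumes "pos_def (blk3 M11 M12 (M13::real^'c^'a) M22 M23 M33)" and "q \<noteq> 0"
  shows "0 < q \<bullet> (M22 *v q)"
proof -
  have "vec3 (0::real^'a) q (0::real^'c) \<noteq> 0" using assms(2) by (simp add: vec3_eq_0_iff)
  then have "0 < vec3 0 q 0 \<bullet> (blk3 M11 M12 M13 M22 M23 M33 *v vec3 0 q (0::real^'c))"
    using assms(1) unfolding pos_def_def by blast
  then show ?thesis by (simp add: quadratic_form_blk3)
qed

lemma invertible_if_sym_part_dominates:
  fixes Y P :: "real^'n^'n"
  assumes P: "pos_def P" and Y: "\<And>q. q \<noteq> 0 \<Longrightarrow> 0 < q \<bullet> ((transpose Y + Y - P) *v q)"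
  shows "invertible Y"
proof (rule invertible_if_kernel_trivial, rule ccontr)
  fix v assume Yv: "Y *v v = 0" and "v \<noteq> 0"
  with Y have "0 < v \<bullet> ((transpose Y + Y - P) *v v)" by blast
  also have "\<dots> = - (v \<bullet> (P *v v))"
    using Yv by (simp add: matrix_vector_mult_diff_rdistrib matrix_vector_mult_add_rdistrib
        inner_diff_right inner_add_right inner_vector_matrix)
  finally show False using pos_def_nonneg[OF P, of v] by simp
qed

lemma lmi_dissipation:
  fixes Q U N :: "real^'n^'n" and C :: "real^'n^'m" and V :: "real^'m^'n"
  assumes LMI: "pos_def (blk3 ((1 - \<rho>) *\<^sub>R Q - \<eta> *\<^sub>R (transpose C ** C)) (transpose N)
                    (0 :: real^'m^'n) (U + transpose U - Q) (\<beta> *\<^sub>R V) (\<eta> *\<^sub>R mat 1))"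
    and "0 \<le> \<eta>" and z: "norm z \<le> norm (C *v e)"
    and step: "U *v e' = N *v e + \<beta> *\<^sub>R (V *v z)"
  shows "e' \<bullet> (Q *v e') \<le> (1 - \<rho>) * (e \<bullet> (Q *v e))"
proof -
  \<comment> \<open>At (e, -e', z) the form of the LMI is
    (1 - \<rho>) e.Qe - e'.Qe' + 2 e'.(Ue' - Ne - \<beta>Vz) + \<eta> (|z|^2 - |Ce|^2).\<close>
  have "0 \<le> vec3 e (- e') z \<bullet> (blk3 ((1 - \<rho>) *\<^sub>R Q - \<eta> *\<^sub>R (transpose C ** C)) (transpose N)
                    0 (U + transpose U - Q) (\<beta> *\<^sub>R V) (\<eta> *\<^sub>R mat 1) *v vec3 e (- e') z)"
    by (rule pos_def_nonneg[OF LMI])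
  also have "\<dots> = (1 - \<rho>) * (e \<bullet> (Q *v e)) - e' \<bullet> (Q *v e')
      + 2 * (e' \<bullet> (U *v e' - N *v e - \<beta> *\<^sub>R (V *v z))) + \<eta> * ((norm z)\<^sup>2 - (norm (C *v e))\<^sup>2)"
    by (simp add: quadratic_form_blk3 scaleR_matrix_vector_assoc[symmetric] matrix_vector_mul_assoc[symmetric] matrix_vector_mult_uminus
        inner_vector_matrix power2_norm_eq_inner inner_commute
        algebra_simps)
  also have "\<dots> \<le> (1 - \<rho>) * (e \<bullet> (Q *v e)) - e' \<bullet> (Q *v e')"
    using step mult_left_mono[OF power_mono[OF z norm_ge_zero] \<open>0 \<le> \<eta>\<close>, of 2]
    by (simp add: right_diff_distrib)
  finally show ?thesis by simp
qed

lemma inner_witness_norm_le: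
  fixes u r w :: "'a::real_inner"
  assumes "norm r \<le> norm u"
  obtains z where "u \<bullet> z = w \<bullet> r" and "norm z \<le> norm w"
proof (cases "u = 0")
  case True
  with assms show thesis by (intro that[of 0]) simp_all
next
  case False
  show thesis
  proof (rule that[of "((w \<bullet> r) / (norm u)\<^sup>2) *\<^sub>R u"])
    show "u \<bullet> (((w \<bullet> r) / (norm u)\<^sup>2) *\<^sub>R u) = w \<bullet> r"
      using False by (simp add: power2_norm_eq_inner)
    have "norm (((w \<bullet> r) / (norm u)\<^sup>2) *\<^sub>R u) = \<bar>w \<bullet> r\<bar> / norm u"
      using False by (simp add: power2_eq_square)
    also have "\<dots> \<le> norm w * norm r / norm u"
      by (simp add: divide_right_mono Cauchy_Schwarz_ineq2)
    also have "\<dots> \<le> norm w" using False assms by (simp add: divide_le_eq mult_left_mono)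
    finally show "norm (((w \<bullet> r) / (norm u)\<^sup>2) *\<^sub>R u) \<le> norm w" .
  qed
qed

lemma quadratic_form_matrix_inv_decrease:
  fixes P :: "real^'n^'n"
  assumes P: "pos_def P" and "\<rho> \<le> 1"
    and f: "f \<bullet> (P *v f) \<le> (1 - \<rho>) * (g \<bullet> (matrix_inv P *v g))"
    and xf: "x \<bullet> f = g \<bullet> (matrix_inv P *v g)"
  shows "g \<bullet> (matrix_inv P *v g) \<le> (1 - \<rho>) * (x \<bullet> (matrix_inv P *v x))"
proof -
  define W where "W = matrix_inv P"
  have PW: "P ** W = mat 1"
    unfolding W_def by (rule matrix_inv_inverse(1)[OF pos_def_invertible[OF P]])
  have W: "pos_def W" unfolding W_def using P by (rule pos_def_matrix_inv)
  have "x \<bullet> f = (W *v x) \<bullet> (P *v f)"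
    using P inner_symmetric_matrix[of P "W *v x" f]
    by (simp add: pos_def_def matrix_vector_mul_assoc PW inner_commute)
  moreover have "(W *v x) \<bullet> (P *v (W *v x)) = x \<bullet> (W *v x)"
    by (simp add: matrix_vector_mul_assoc PW inner_commute)
  ultimately have "(g \<bullet> (W *v g))\<^sup>2 \<le> (x \<bullet> (W *v x)) * (f \<bullet> (P *v f))"
    using pos_def_cauchy_schwarz[OF P, of "W *v x" f] xf by (simp add: W_def)
  also have "\<dots> \<le> (x \<bullet> (W *v x)) * ((1 - \<rho>) * (g \<bullet> (W *v g)))"
    using f pos_def_nonneg[OF W] by (simp add: W_def mult_left_mono)
  finally have "(g \<bullet> (W *v g)) * (g \<bullet> (W *v g)) \<le> ((1 - \<rho>) * (x \<bullet> (W *v x))) * (g \<bullet> (W *v g))"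
    by (simp add: power2_eq_square algebra_simps)
  then show ?thesis
    using pos_def_nonneg[OF W, of g] pos_def_nonneg[OF W, of x] \<open>\<rho> \<le> 1\<close> unfolding W_def[symmetric]
    by (cases "g \<bullet> (W *v g) = 0") (simp_all add: mult_le_cancel_right)
qed

lemma controller_lmi_decrease:
  fixes A P Y :: "real^'n^'n" and B :: "real^'u^'n" and X K :: "real^'n^'u"
  assumes LMI: "pos_def (blk3 ((1 - \<rho>) *\<^sub>R P - \<sigma> *\<^sub>R (B ** transpose B))
                    (A ** Y + \<alpha> *\<^sub>R (B ** X)) (0 :: real^'u^'n)
                    (transpose Y + Y - P) (\<beta> *\<^sub>R transpose X) (\<sigma> *\<^sub>R mat 1))"
    and "0 \<le> \<sigma>" and P: "pos_def P" and "\<rho> \<le> 1"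
    and KY: "K ** Y = X" and r: "norm r \<le> norm (K *v x)"
  shows "(A *v x + B *v (\<alpha> *\<^sub>R (K *v x) + \<beta> *\<^sub>R r))
           \<bullet> (matrix_inv P *v (A *v x + B *v (\<alpha> *\<^sub>R (K *v x) + \<beta> *\<^sub>R r)))
         \<le> (1 - \<rho>) * (x \<bullet> (matrix_inv P *v x))"
proof -
  define W where "W = matrix_inv P"
  define g where "g = A *v x + B *v (\<alpha> *\<^sub>R (K *v x) + \<beta> *\<^sub>R r)"
  have PW: "P ** W = mat 1"
    unfolding W_def by (rule matrix_inv_inverse(1)[OF pos_def_invertible[OF P]])
  \<comment> \<open>The controller LMI is the observer LMI of the dual system (A', B', Y', X').\<close>
  have dual: "pos_def (blk3 ((1 - \<rho>) *\<^sub>R P - \<sigma> *\<^sub>R (transpose (transpose B) ** transpose B))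
                    (transpose (transpose (A ** Y + \<alpha> *\<^sub>R (B ** X)))) (0 :: real^'u^'n)
                    (transpose Y + transpose (transpose Y) - P) (\<beta> *\<^sub>R transpose X) (\<sigma> *\<^sub>R mat 1))"
    using LMI by simp
  define y where "y = W *v g"
  define w where "w = transpose B *v y"
  \<comment> \<open>One step of the dual loop from y = P^-1 g, with z chosen so that x.f = g.y.\<close>
  obtain z where Kz: "(K *v x) \<bullet> z = w \<bullet> r" and z: "norm z \<le> norm w"
    using inner_witness_norm_le[OF r] by blast
  define f where "f = transpose A *v y + transpose K *v (\<alpha> *\<^sub>R w + \<beta> *\<^sub>R z)"
  have "transpose Y *v f = transpose (A ** Y + \<alpha> *\<^sub>R (B ** X)) *v y + \<beta> *\<^sub>R (transpose X *v z)"
    unfolding f_def w_def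
    by (simp add: vector_matrix_left_distrib vector_matrix_mult_add_rdistrib scaleR_vector_matrix_assoc
        vector_scaleR_matrix_ac vector_matrix_mul_assoc matrix_mul_assoc[symmetric] KY)
  then have f: "f \<bullet> (P *v f) \<le> (1 - \<rho>) * (y \<bullet> (P *v y))"
    using lmi_dissipation[OF dual \<open>0 \<le> \<sigma>\<close> z[unfolded w_def]] by simp
  from Kz have xf: "x \<bullet> f = g \<bullet> y"
    unfolding f_def g_def w_def
    by (simp add: inner_add_right inner_add_left inner_vector_matrix inner_commute
        matrix_vector_right_distrib matrix_vector_mult_scaleR)
  have "y \<bullet> (P *v y) = g \<bullet> (W *v g)"
    by (simp add: y_def matrix_vector_mul_assoc PW inner_commute)
  with f xf have "f \<bullet> (P *v f) \<le> (1 - \<rho>) * (g \<bullet> (matrix_inv P *v g))" "x \<bullet> f = g \<bullet> (matrix_inv P *v g)"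
    by (simp_all add: y_def W_def)
  from quadratic_form_matrix_inv_decrease[OF P \<open>\<rho> \<le> 1\<close> this] show ?thesis
    by (simp add: g_def)
qed

lemma sector_bound_of_jacobian:
  fixes S :: "real^'n \<Rightarrow> real^'n" and J :: "real^'n \<Rightarrow> real^'n^'n"
  assumes deriv: "\<And>v. (S has_derivative (\<lambda>h. J v *v h)) (at v)"
    and bound: "\<And>v. spec_norm (J v - \<alpha> *\<^sub>R mat 1) \<le> \<beta>"
  shows "norm (S a - S b - \<alpha> *\<^sub>R (a - b)) \<le> \<beta> * norm (a - b)"
proof -
  have "norm ((S a - \<alpha> *\<^sub>R a) - (S b - \<alpha> *\<^sub>R b)) \<le> \<beta> * norm (a - b)"
  proof (rule differentiable_bound[where S = UNIV and f' = "\<lambda>v h. (J v - \<alpha> *\<^sub>R mat 1) *v h"])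
    fix v :: "real^'n"
    have "(\<lambda>h. J v *v h - \<alpha> *\<^sub>R h) = (\<lambda>h. (J v - \<alpha> *\<^sub>R mat 1) *v h)"
      by (simp add: fun_eq_iff matrix_vector_mult_diff_rdistrib scaleR_matrix_vector_assoc[symmetric])
    then show "((\<lambda>v. S v - \<alpha> *\<^sub>R v) has_derivative (\<lambda>h. (J v - \<alpha> *\<^sub>R mat 1) *v h)) (at v within UNIV)"
      using deriv[of v] by (auto intro!: derivative_eq_intros)
    show "onorm (\<lambda>h. (J v - \<alpha> *\<^sub>R mat 1) *v h) \<le> \<beta>"
      using bound[of v] by (simp add: spec_norm_def)
  qed auto
  then show ?thesis by (simp add: algebra_simps)
qed

lemma sector_decompose:
  fixes d w :: "'a::real_normed_vector"
  assumes "norm (d - \<alpha> *\<^sub>R w) \<le> \<beta> * norm w" and "0 \<le> \<beta>"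
  obtains r where "d = \<alpha> *\<^sub>R w + \<beta> *\<^sub>R r" and "norm r \<le> norm w"
proof (cases "\<beta> = 0")
  case True
  with assms show thesis by (intro that[of 0]) simp_all
next
  case False
  with assms have "0 < \<beta>" by simp
  show thesis
  proof (rule that[of "(1 / \<beta>) *\<^sub>R (d - \<alpha> *\<^sub>R w)"])
    show "d = \<alpha> *\<^sub>R w + \<beta> *\<^sub>R ((1 / \<beta>) *\<^sub>R (d - \<alpha> *\<^sub>R w))" using \<open>0 < \<beta>\<close> by simp
    show "norm ((1 / \<beta>) *\<^sub>R (d - \<alpha> *\<^sub>R w)) \<le> norm w"
      using \<open>0 < \<beta>\<close> assms(1) by (simp add: divide_le_eq mult.commute)
  qed
qed

lemma sector_lipschitz:
  fixes S :: "'a::real_normed_vector \<Rightarrow> 'a"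
  assumes "norm (S a - S b - \<alpha> *\<^sub>R (a - b)) \<le> \<beta> * norm (a - b)"
  shows "norm (S a - S b) \<le> (\<bar>\<alpha>\<bar> + \<beta>) * norm (a - b)"
  using norm_triangle_sub[of "S a - S b" "\<alpha> *\<^sub>R (a - b)"] assms by (simp add: distrib_right)

lemma observer_error_decrease:
  fixes A Q U :: "real^'n^'n" and C :: "real^'n^'m" and V :: "real^'m^'n"
    and Sy :: "real^'m \<Rightarrow> real^'m"
  assumes Q: "pos_def Q"
    and LMI: "pos_def (blk3 ((1 - \<rho>) *\<^sub>R Q - \<eta> *\<^sub>R (transpose C ** C))
                    (transpose (U ** A + \<alpha> *\<^sub>R (V ** C))) (0 :: real^'m^'n)
                    (U + transpose U - Q) (\<beta> *\<^sub>R V) (\<eta> *\<^sub>R mat 1))"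
    and "0 \<le> \<eta>" and "0 \<le> \<beta>"
    and sector: "\<And>a b. norm (Sy a - Sy b - \<alpha> *\<^sub>R (a - b)) \<le> \<beta> * norm (a - b)"
  shows "(A *v (x' - x) + (matrix_inv U ** V) *v (Sy (C *v x' + d) - Sy (C *v x + d)))
           \<bullet> (Q *v (A *v (x' - x) + (matrix_inv U ** V) *v (Sy (C *v x' + d) - Sy (C *v x + d))))
         \<le> (1 - \<rho>) * ((x' - x) \<bullet> (Q *v (x' - x)))"
proof -
  define e where "e = x' - x"
  define \<Delta> where "\<Delta> = Sy (C *v x' + d) - Sy (C *v x + d)"
  have "invertible U"
    using Q pos_def_blk3_middle[OF LMI]
    by (intro invertible_if_sym_part_dominates) (simp_all add: add.commute)
  then have UL: "U *v ((matrix_inv U ** V) *v w) = V *v w" for w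
    by (simp add: matrix_vector_mul_assoc matrix_mul_assoc matrix_inv_inverse)
  have "(C *v x' + d) - (C *v x + d) = C *v e" by (simp add: e_def matrix_vector_mult_diff_distrib)
  then obtain r where r: "\<Delta> = \<alpha> *\<^sub>R (C *v e) + \<beta> *\<^sub>R r" "norm r \<le> norm (C *v e)"
    using sector_decompose[OF sector[of "C *v x' + d" "C *v x + d"] \<open>0 \<le> \<beta>\<close>] by (auto simp: \<Delta>_def)
  have "U *v (A *v e + (matrix_inv U ** V) *v \<Delta>) = (U ** A + \<alpha> *\<^sub>R (V ** C)) *v e + \<beta> *\<^sub>R (V *v r)"
    unfolding r(1)
    by (simp only: matrix_vector_right_distrib matrix_vector_mult_scaleR UL)
      (simp add: matrix_vector_mult_add_rdistrib scaleR_matrix_vector_assoc[symmetric] matrix_vector_mul_assoc)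
  then show ?thesis
    unfolding e_def[symmetric] \<Delta>_def[symmetric] by (rule lmi_dissipation[OF LMI \<open>0 \<le> \<eta>\<close> r(2)])
qed

lemma quadratic_form_perturbed_decrease:
  fixes W :: "real^'n^'n"
  assumes W: "pos_def W" and "0 < \<rho>" and "\<rho> \<le> 1" and "0 \<le> s"
    and g: "g \<bullet> (W *v g) \<le> (1 - \<rho>) * s"
  shows "(g + h) \<bullet> (W *v (g + h)) \<le> (1 - \<rho> / 2) * s + (1 + 2 / \<rho>) * spec_norm W * (norm h)\<^sup>2"
proof -
  have "(g + h) \<bullet> (W *v (g + h)) \<le> (1 + \<rho> / 2) * (g \<bullet> (W *v g)) + (1 + 2 / \<rho>) * (h \<bullet> (W *v h))"
    using quadratic_form_young[OF W, of "\<rho> / 2" g h] \<open>0 < \<rho>\<close> by simp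
  also have "(1 + \<rho> / 2) * (g \<bullet> (W *v g)) \<le> ((1 + \<rho> / 2) * (1 - \<rho>)) * s"
    using mult_left_mono[OF g, of "1 + \<rho> / 2"] \<open>0 < \<rho>\<close> by (simp add: mult.assoc)
  also have "\<dots> \<le> (1 - \<rho> / 2) * s"
    using \<open>0 < \<rho>\<close> \<open>0 \<le> s\<close> by (intro mult_right_mono) (simp_all add: algebra_simps)
  also have "(1 + 2 / \<rho>) * (h \<bullet> (W *v h)) \<le> (1 + 2 / \<rho>) * (spec_norm W * (norm h)\<^sup>2)"
    using \<open>0 < \<rho>\<close> quadratic_form_le_spec_norm[of h W] by (intro mult_left_mono) simp_all
  finally show ?thesis by (simp add: mult.assoc)
qed

lemma controller_state_decrease:
  fixes A P Y :: "real^'n^'n" and B :: "real^'u^'n" and X :: "real^'n^'u"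
    and Su :: "real^'u \<Rightarrow> real^'u"
  defines "K \<equiv> X ** matrix_inv Y" and "W \<equiv> matrix_inv P"
  assumes P: "pos_def P"
    and LMI: "pos_def (blk3 ((1 - \<rho>) *\<^sub>R P - \<sigma> *\<^sub>R (B ** transpose B))
                    (A ** Y + \<alpha> *\<^sub>R (B ** X)) (0 :: real^'u^'n)
                    (transpose Y + Y - P) (\<beta> *\<^sub>R transpose X) (\<sigma> *\<^sub>R mat 1))"
    and "0 \<le> \<sigma>" and "0 < \<rho>" and "\<rho> \<le> 1" and "0 \<le> \<alpha>" and "0 \<le> \<beta>"
    and sector: "\<And>a b. norm (Su a - Su b - \<alpha> *\<^sub>R (a - b)) \<le> \<beta> * norm (a - b)"
    and "Su 0 = 0"
  obtains c where "0 \<le> c"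
    and "\<And>x x'. (A *v x + B *v Su (K *v x')) \<bullet> (W *v (A *v x + B *v Su (K *v x')))
                  \<le> (1 - \<rho> / 2) * (x \<bullet> (W *v x)) + c * (norm (x' - x))\<^sup>2"
proof
  have "invertible Y"
    using P pos_def_blk3_middle[OF LMI] by (rule invertible_if_sym_part_dominates)
  then have KY: "K ** Y = X"
    by (simp add: K_def matrix_mul_assoc[symmetric] matrix_inv_inverse)
  have W: "pos_def W" unfolding W_def using P by (rule pos_def_matrix_inv)
  define k where "k = spec_norm B * (\<alpha> + \<beta>) * spec_norm K"
  show "0 \<le> (1 + 2 / \<rho>) * spec_norm W * k\<^sup>2"
    using \<open>0 < \<rho>\<close> by (simp add: spec_norm_nonneg)
  fix x x' :: "real^'n"
  obtain r where r: "Su (K *v x) = \<alpha> *\<^sub>R (K *v x) + \<beta> *\<^sub>R r" "norm r \<le> norm (K *v x)"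
    using sector_decompose[OF sector[of "K *v x" 0]] \<open>Su 0 = 0\<close> \<open>0 \<le> \<beta>\<close> by auto
  define h where "h = B *v (Su (K *v x') - Su (K *v x))"
  have split: "A *v x + B *v Su (K *v x') = (A *v x + B *v Su (K *v x)) + h"
    by (simp add: h_def matrix_vector_mult_diff_distrib)
  have nominal: "(A *v x + B *v Su (K *v x)) \<bullet> (W *v (A *v x + B *v Su (K *v x))) \<le> (1 - \<rho>) * (x \<bullet> (W *v x))"
    unfolding r(1) W_def using controller_lmi_decrease[OF LMI \<open>0 \<le> \<sigma>\<close> P \<open>\<rho> \<le> 1\<close> KY r(2)] .
  have "norm h \<le> k * norm (x' - x)"
  proof -
    have "norm h \<le> spec_norm B * norm (Su (K *v x') - Su (K *v x))"
      unfolding h_def by (rule norm_matrix_vector_le_spec_norm)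
    also have "\<dots> \<le> spec_norm B * ((\<alpha> + \<beta>) * norm (K *v (x' - x)))"
      using sector_lipschitz[OF sector[of "K *v x'" "K *v x"]] \<open>0 \<le> \<alpha>\<close>
      by (simp add: mult_left_mono spec_norm_nonneg matrix_vector_mult_diff_distrib)
    also have "\<dots> \<le> spec_norm B * ((\<alpha> + \<beta>) * (spec_norm K * norm (x' - x)))"
      using \<open>0 \<le> \<alpha>\<close> \<open>0 \<le> \<beta>\<close>
      by (intro mult_left_mono norm_matrix_vector_le_spec_norm) (simp_all add: spec_norm_nonneg)
    finally show ?thesis by (simp add: k_def mult.assoc)
  qed
  then have "(1 + 2 / \<rho>) * spec_norm W * (norm h)\<^sup>2 \<le> (1 + 2 / \<rho>) * spec_norm W * k\<^sup>2 * (norm (x' - x))\<^sup>2"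
    using \<open>0 < \<rho>\<close>
    by (simp add: mult.assoc power_mult_distrib[symmetric] mult_left_mono power_mono spec_norm_nonneg)
  with quadratic_form_perturbed_decrease[OF W \<open>0 < \<rho>\<close> \<open>\<rho> \<le> 1\<close> pos_def_nonneg[OF W] nominal, of h]
  show "(A *v x + B *v Su (K *v x')) \<bullet> (W *v (A *v x + B *v Su (K *v x')))
      \<le> (1 - \<rho> / 2) * (x \<bullet> (W *v x)) + (1 + 2 / \<rho>) * spec_norm W * k\<^sup>2 * (norm (x' - x))\<^sup>2"
    unfolding split by linarith
qed

lemma cascade_lyapunov_decay:
  fixes a q :: "nat \<Rightarrow> real"
  assumes a: "\<And>k. a (Suc k) \<le> ra * a k + c * q k" and q: "\<And>k. q (Suc k) \<le> rq * q k"
    and a0: "\<And>k. 0 \<le> a k" and q0: "\<And>k. 0 \<le> q k"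
    and "ra \<le> l" and "c + d * rq \<le> d * l" and "0 \<le> d" and "0 \<le> l"
  shows "a k + d * q k \<le> l ^ k * (a 0 + d * q 0)"
proof (induction k)
  case (Suc k)
  have "a (Suc k) + d * q (Suc k) \<le> ra * a k + (c + d * rq) * q k"
    using a[of k] mult_left_mono[OF q[of k] \<open>0 \<le> d\<close>] by (simp add: algebra_simps)
  also have "\<dots> \<le> l * a k + (d * l) * q k"
    using assms(5,6) a0[of k] q0[of k] by (intro add_mono mult_right_mono) simp_all
  also have "\<dots> \<le> l * (l ^ k * (a 0 + d * q 0))"
    using mult_left_mono[OF Suc.IH \<open>0 \<le> l\<close>] by (simp add: algebra_simps)
  finally show ?case by simp
qed simp

lemma sum_le_of_sum_squares_decay:
  fixes s t s0 t0 V V0 :: real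
  assumes "0 < m" and "0 < M" and "0 \<le> l" and "0 \<le> s0 + t0"
    and lower: "m * (s\<^sup>2 + t\<^sup>2) \<le> V" and decay: "V \<le> l ^ k * V0"
    and upper: "V0 \<le> M * (s0 + t0)\<^sup>2"
  shows "s + t \<le> sqrt (2 * M / m) * sqrt l ^ k * (s0 + t0)"
proof -
  have "(s + t)\<^sup>2 \<le> 2 * (s\<^sup>2 + t\<^sup>2)"
    using zero_le_square[of "s - t"] by (simp add: power2_eq_square algebra_simps)
  also have "\<dots> \<le> 2 * (V / m)" using lower \<open>0 < m\<close> by (simp add: field_simps)
  also have "\<dots> \<le> 2 * (l ^ k * (M * (s0 + t0)\<^sup>2) / m)"
    using order_trans[OF decay mult_left_mono[OF upper]] \<open>0 \<le> l\<close> \<open>0 < m\<close>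
    by (simp add: divide_right_mono)
  also have "\<dots> = (sqrt (2 * M / m * l ^ k) * (s0 + t0))\<^sup>2"
    using \<open>0 < M\<close> \<open>0 < m\<close> \<open>0 \<le> l\<close> by (simp add: power_mult_distrib)
  finally have "s + t \<le> sqrt (2 * M / m * l ^ k) * (s0 + t0)"
    by (rule power2_le_imp_le) (use \<open>0 < M\<close> \<open>0 < m\<close> \<open>0 \<le> l\<close> \<open>0 \<le> s0 + t0\<close> in simp)
  then show ?thesis
    unfolding real_sqrt_power[symmetric] real_sqrt_mult[symmetric] .
qed

lemma weighted_sum_quadratic_bounds:
  fixes Vx Ve :: "'a::real_normed_vector \<Rightarrow> real"
  assumes Vx: "\<And>v. mx * (norm v)\<^sup>2 \<le> Vx v" "\<And>v. Vx v \<le> Mx * (norm v)\<^sup>2"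
    and Ve: "\<And>v. me * (norm v)\<^sup>2 \<le> Ve v" "\<And>v. Ve v \<le> Me * (norm v)\<^sup>2"
    and "0 \<le> d"
  shows "min mx (d * me) * ((norm x)\<^sup>2 + (norm e)\<^sup>2) \<le> Vx x + d * Ve e"
    and "Vx x + d * Ve e \<le> max 1 (max Mx (d * Me)) * (norm x + norm e)\<^sup>2"
proof -
  let ?m = "min mx (d * me)" and ?M = "max 1 (max Mx (d * Me))"
  have "?m * (norm x)\<^sup>2 \<le> mx * (norm x)\<^sup>2" "?m * (norm e)\<^sup>2 \<le> d * (me * (norm e)\<^sup>2)"
    by (simp_all add: mult_right_mono mult.assoc[symmetric])
  moreover have "d * (me * (norm e)\<^sup>2) \<le> d * Ve e"
    using Ve(1) \<open>0 \<le> d\<close> by (simp add: mult_left_mono)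
  ultimately show "?m * ((norm x)\<^sup>2 + (norm e)\<^sup>2) \<le> Vx x + d * Ve e"
    using Vx(1)[of x] unfolding distrib_left by linarith
  have "Mx * (norm x)\<^sup>2 \<le> ?M * (norm x)\<^sup>2" "d * Me * (norm e)\<^sup>2 \<le> ?M * (norm e)\<^sup>2"
    by (simp_all add: mult_right_mono)
  moreover have "d * Ve e \<le> d * Me * (norm e)\<^sup>2"
    using Ve(2) \<open>0 \<le> d\<close> by (simp add: mult_left_mono mult.assoc)
  moreover have "?M * (norm x)\<^sup>2 + ?M * (norm e)\<^sup>2 \<le> ?M * (norm x + norm e)\<^sup>2"
    by (simp add: power2_sum distrib_left)
  ultimately show "Vx x + d * Ve e \<le> ?M * (norm x + norm e)\<^sup>2"
    using Vx(2)[of x] by linarith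
qed

lemma cascade_exponential_stability:
  fixes Vx Ve :: "'a::real_normed_vector \<Rightarrow> real"
  assumes "0 < mx" and Vx: "\<And>v. mx * (norm v)\<^sup>2 \<le> Vx v" "\<And>v. Vx v \<le> Mx * (norm v)\<^sup>2"
    and "0 < me" and Ve: "\<And>v. me * (norm v)\<^sup>2 \<le> Ve v" "\<And>v. Ve v \<le> Me * (norm v)\<^sup>2"
    and "rx < 1" and "0 \<le> re" and "re < 1" and "0 \<le> c"
  obtains C \<theta> where "0 < C" and "0 < \<theta>" and "\<theta> < 1"
    and "\<And>x e k. \<forall>k. Vx (x (Suc k)) \<le> rx * Vx (x k) + c * (norm (e k))\<^sup>2 \<Longrightarrow>
                 \<forall>k. Ve (e (Suc k)) \<le> re * Ve (e k) \<Longrightarrow>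
                 norm (x k) + norm (e k) \<le> C * \<theta> ^ k * (norm (x 0) + norm (e 0))"
proof
  \<comment> \<open>The weight d makes the coupling term c/me absorbable by the contraction of Ve.\<close>
  define d where "d = 2 * (c / me) / (1 - re) + 1"
  define l where "l = max rx ((1 + re) / 2)"
  define m where "m = min mx (d * me)"
  define M where "M = max 1 (max Mx (d * Me))"
  have "0 < d" using \<open>0 \<le> c\<close> \<open>0 < me\<close> \<open>re < 1\<close> by (simp add: d_def add_nonneg_pos)
  have "0 < l" "l < 1" using \<open>0 \<le> re\<close> \<open>re < 1\<close> \<open>rx < 1\<close> by (simp_all add: l_def less_max_iff_disj)
  have "0 < m" using \<open>0 < mx\<close> \<open>0 < me\<close> \<open>0 < d\<close> by (simp add: m_def)
  have "0 < M" by (simp add: M_def)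
  show "0 < sqrt (2 * M / m)" using \<open>0 < M\<close> \<open>0 < m\<close> by simp
  show "0 < sqrt l" "sqrt l < 1" using \<open>0 < l\<close> \<open>l < 1\<close> by simp_all
  fix x e :: "nat \<Rightarrow> 'a" and k :: nat
  assume x: "\<forall>k. Vx (x (Suc k)) \<le> rx * Vx (x k) + c * (norm (e k))\<^sup>2"
    and e: "\<forall>k. Ve (e (Suc k)) \<le> re * Ve (e k)"
  have "Vx (x (Suc k)) \<le> rx * Vx (x k) + c / me * Ve (e k)" for k
  proof -
    have "c * (norm (e k))\<^sup>2 = c / me * (me * (norm (e k))\<^sup>2)" using \<open>0 < me\<close> by simp
    also have "\<dots> \<le> c / me * Ve (e k)"
      using \<open>0 \<le> c\<close> \<open>0 < me\<close> by (intro mult_left_mono Ve(1)) simp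
    finally show ?thesis using x by (meson add_left_mono order_trans)
  qed
  moreover have "0 \<le> Vx (x k)" "0 \<le> Ve (e k)" for k
    using Vx(1)[of "x k"] Ve(1)[of "e k"] \<open>0 < mx\<close> \<open>0 < me\<close>
    by (meson order_trans mult_nonneg_nonneg less_imp_le zero_le_power2)+
  moreover have "c / me + d * re \<le> d * l"
  proof -
    have "d * (1 - re) = 2 * (c / me) + (1 - re)" using \<open>re < 1\<close> \<open>0 < me\<close> by (simp add: d_def field_simps)
    then have "c / me + d * re \<le> d * ((1 + re) / 2)" using \<open>re < 1\<close> by (simp add: field_simps)
    also have "\<dots> \<le> d * l" using \<open>0 < d\<close> by (intro mult_left_mono) (simp_all add: l_def)
    finally show ?thesis .
  qed
  ultimately have decay: "Vx (x k) + d * Ve (e k) \<le> l ^ k * (Vx (x 0) + d * Ve (e 0))"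
    using e \<open>0 < d\<close> \<open>0 < l\<close>
    by (intro cascade_lyapunov_decay[where ra = rx and rq = re]) (simp_all add: l_def)
  have lower: "m * ((norm (x k))\<^sup>2 + (norm (e k))\<^sup>2) \<le> Vx (x k) + d * Ve (e k)"
    and upper: "Vx (x 0) + d * Ve (e 0) \<le> M * (norm (x 0) + norm (e 0))\<^sup>2"
    unfolding m_def M_def using weighted_sum_quadratic_bounds[OF Vx Ve] \<open>0 < d\<close> by simp_all
  show "norm (x k) + norm (e k) \<le> sqrt (2 * M / m) * sqrt l ^ k * (norm (x 0) + norm (e 0))"
    by (rule sum_le_of_sum_squares_decay[OF \<open>0 < m\<close> \<open>0 < M\<close> _ _ lower decay upper])
      (use \<open>0 < l\<close> in simp_all)
qed

lemma closed_loop_exponential_stability: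
  fixes A W Q :: "real^'n^'n" and B :: "real^'u^'n" and C :: "real^'n^'m" and D :: "real^'u^'m"
    and K :: "real^'n^'u" and L :: "real^'m^'n"
    and Su :: "real^'u \<Rightarrow> real^'u" and Sy :: "real^'m \<Rightarrow> real^'m"
  assumes W: "pos_def W" and Q: "pos_def Q"
    and ctrl: "\<And>x x'. (A *v x + B *v Su (K *v x')) \<bullet> (W *v (A *v x + B *v Su (K *v x')))
                  \<le> rx * (x \<bullet> (W *v x)) + c * (norm (x' - x))\<^sup>2"
    and obs: "\<And>x x' d. (A *v (x' - x) + L *v (Sy (C *v x' + d) - Sy (C *v x + d)))
                  \<bullet> (Q *v (A *v (x' - x) + L *v (Sy (C *v x' + d) - Sy (C *v x + d))))
                \<le> re * ((x' - x) \<bullet> (Q *v (x' - x)))"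
    and "rx < 1" and "0 \<le> re" and "re < 1" and "0 \<le> c"
  shows "\<exists>\<kappa> \<theta>. 0 < \<kappa> \<and> 0 < \<theta> \<and> \<theta> < 1 \<and>
    (\<forall>x xh :: nat \<Rightarrow> real^'n.
       (\<forall>k. x (Suc k) = A *v x k + B *v Su (K *v xh k)
          \<and> xh (Suc k) = A *v xh k + B *v Su (K *v xh k)
              + L *v (Sy (C *v xh k + D *v Su (K *v xh k)) - Sy (C *v x k + D *v Su (K *v xh k))))
       \<longrightarrow> (\<forall>k. norm (x k) + norm (xh k - x k) \<le> \<kappa> * \<theta> ^ k * (norm (x 0) + norm (xh 0 - x 0))))"
proof -
  obtain mW where mW: "0 < mW" "\<And>v. mW * (norm v)\<^sup>2 \<le> v \<bullet> (W *v v)"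
    using pos_def_coercive[OF W] by blast
  obtain mQ where mQ: "0 < mQ" "\<And>v. mQ * (norm v)\<^sup>2 \<le> v \<bullet> (Q *v v)"
    using pos_def_coercive[OF Q] by blast
  obtain \<kappa> \<theta> where "0 < \<kappa>" "0 < \<theta>" "\<theta> < 1" and decay: "\<And>x e k.
      \<forall>k. x (Suc k) \<bullet> (W *v x (Suc k)) \<le> rx * (x k \<bullet> (W *v x k)) + c * (norm (e k))\<^sup>2 \<Longrightarrow>
      \<forall>k. e (Suc k) \<bullet> (Q *v e (Suc k)) \<le> re * (e k \<bullet> (Q *v e k)) \<Longrightarrow>
      norm (x k) + norm (e k) \<le> \<kappa> * \<theta> ^ k * (norm (x 0) + norm (e 0))"
    using cascade_exponential_stability[OF mW quadratic_form_le_spec_norm mQ quadratic_form_le_spec_norm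
        \<open>rx < 1\<close> \<open>0 \<le> re\<close> \<open>re < 1\<close> \<open>0 \<le> c\<close>] by blast
  show ?thesis
  proof (intro exI conjI allI impI)
    fix x xh :: "nat \<Rightarrow> real^'n" and k :: nat
    assume closed_loop: "\<forall>k. x (Suc k) = A *v x k + B *v Su (K *v xh k)
          \<and> xh (Suc k) = A *v xh k + B *v Su (K *v xh k)
              + L *v (Sy (C *v xh k + D *v Su (K *v xh k)) - Sy (C *v x k + D *v Su (K *v xh k)))"
    show "norm (x k) + norm (xh k - x k) \<le> \<kappa> * \<theta> ^ k * (norm (x 0) + norm (xh 0 - x 0))"
    proof (rule decay)
      show "\<forall>k. x (Suc k) \<bullet> (W *v x (Suc k)) \<le> rx * (x k \<bullet> (W *v x k)) + c * (norm (xh k - x k))\<^sup>2"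
        using closed_loop ctrl by simp
      show "\<forall>k. (xh (Suc k) - x (Suc k)) \<bullet> (Q *v (xh (Suc k) - x (Suc k)))
              \<le> re * ((xh k - x k) \<bullet> (Q *v (xh k - x k)))"
      proof
        fix k
        let ?d = "D *v Su (K *v xh k)"
        have "xh (Suc k) - x (Suc k) = A *v (xh k - x k) + L *v (Sy (C *v xh k + ?d) - Sy (C *v x k + ?d))"
          using closed_loop by (simp add: matrix_vector_mult_diff_distrib)
        then show "(xh (Suc k) - x (Suc k)) \<bullet> (Q *v (xh (Suc k) - x (Suc k)))
              \<le> re * ((xh k - x k) \<bullet> (Q *v (xh k - x k)))"
          using obs by simp
      qed
    qed
  qed (fact \<open>0 < \<kappa>\<close> \<open>0 < \<theta>\<close> \<open>\<theta> < 1\<close>)+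
qed

theorem mainTheorem6:
  fixes A :: "real^'nx^'nx" and B :: "real^'nu^'nx"
    and C :: "real^'nx^'ny" and D :: "real^'nu^'ny"
    and \<mu>u \<nu>u \<mu>y \<nu>y :: real
    and P Y :: "real^'nx^'nx" and X :: "real^'nx^'nu" and \<sigma> \<rho>c :: real
    and Q U :: "real^'nx^'nx" and V :: "real^'ny^'nx" and \<eta> \<rho>o :: real
    and Su :: "real^'nu \<Rightarrow> real^'nu" and Ju :: "real^'nu \<Rightarrow> real^'nu^'nu"
    and Sy :: "real^'ny \<Rightarrow> real^'ny" and Jy :: "real^'ny \<Rightarrow> real^'ny^'ny"
  assumes mu_u: "0 < \<mu>u" "\<mu>u \<le> \<nu>u"
    and mu_y: "0 < \<mu>y" "\<mu>y \<le> \<nu>y"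
    and LMI_c: "pos_def P" "\<sigma> > 0" "0 < \<rho>c" "\<rho>c < 1"
      "pos_def (blk3 ((1 - \<rho>c) *\<^sub>R P - \<sigma> *\<^sub>R (B ** transpose B))
                     (A ** Y + ((\<nu>u + \<mu>u) / 2) *\<^sub>R (B ** X))
                     (0 :: real^'nu^'nx)
                     (transpose Y + Y - P)
                     (((\<nu>u - \<mu>u) / 2) *\<^sub>R transpose X)
                     (\<sigma> *\<^sub>R mat 1))"
    and LMI_o: "pos_def Q" "\<eta> > 0" "0 < \<rho>o" "\<rho>o < 1"
      "pos_def (blk3 ((1 - \<rho>o) *\<^sub>R Q - \<eta> *\<^sub>R (transpose C ** C))
                     (transpose (U ** A + ((\<nu>y + \<mu>y) / 2) *\<^sub>R (V ** C)))
                     (0 :: real^'ny^'nx)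
                     (U + transpose U - Q)
                     (((\<nu>y - \<mu>y) / 2) *\<^sub>R V)
                     (\<eta> *\<^sub>R mat 1))"
    and Su_deriv: "\<And>v. (Su has_derivative (\<lambda>h. Ju v *v h)) (at v)"
    and Su_C1: "continuous_on UNIV Ju"
    and Su_0: "Su 0 = 0"
    and Ju_bound: "\<And>v. spec_norm (Ju v - ((\<nu>u + \<mu>u) / 2) *\<^sub>R mat 1) \<le> (\<nu>u - \<mu>u) / 2"
    and Sy_deriv: "\<And>z. (Sy has_derivative (\<lambda>h. Jy z *v h)) (at z)"
    and Sy_C1: "continuous_on UNIV Jy"
    and Jy_bound: "\<And>z. spec_norm (Jy z - ((\<nu>y + \<mu>y) / 2) *\<^sub>R mat 1) \<le> (\<nu>y - \<mu>y) / 2"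
  shows "\<exists>c lam. c > 0 \<and> 0 < lam \<and> lam < 1 \<and>
    (\<forall>x xh :: nat \<Rightarrow> real^'nx.
       (\<forall>k. x (Suc k) = A *v x k + B *v Su ((X ** matrix_inv Y) *v xh k)
          \<and> xh (Suc k) = A *v xh k + B *v Su ((X ** matrix_inv Y) *v xh k)
              + (matrix_inv U ** V) *v
                  (Sy (C *v xh k + D *v Su ((X ** matrix_inv Y) *v xh k))
                   - Sy (C *v x k + D *v Su ((X ** matrix_inv Y) *v xh k))))
       \<longrightarrow> (\<forall>k. norm (x k) + norm (xh k - x k)
                 \<le> c * lam ^ k * (norm (x 0) + norm (xh 0 - x 0))))"
proof -
  have "0 \<le> (\<nu>u + \<mu>u) / 2" "0 \<le> (\<nu>u - \<mu>u) / 2" "0 \<le> (\<nu>y - \<mu>y) / 2"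
    using mu_u mu_y by simp_all
  note sector_u = sector_bound_of_jacobian[OF Su_deriv Ju_bound]
  note sector_y = sector_bound_of_jacobian[OF Sy_deriv Jy_bound]
  obtain c where "0 \<le> c" and ctrl: "\<And>x x'.
      (A *v x + B *v Su ((X ** matrix_inv Y) *v x'))
        \<bullet> (matrix_inv P *v (A *v x + B *v Su ((X ** matrix_inv Y) *v x')))
      \<le> (1 - \<rho>c / 2) * (x \<bullet> (matrix_inv P *v x)) + c * (norm (x' - x))\<^sup>2"
    using controller_state_decrease[OF LMI_c(1,5) less_imp_le[OF LMI_c(2)] LMI_c(3) less_imp_le[OF LMI_c(4)]
        \<open>0 \<le> (\<nu>u + \<mu>u) / 2\<close> \<open>0 \<le> (\<nu>u - \<mu>u) / 2\<close> sector_u Su_0] by blast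
  show ?thesis
  proof (rule closed_loop_exponential_stability[OF pos_def_matrix_inv[OF LMI_c(1)] LMI_o(1) ctrl
        observer_error_decrease[OF LMI_o(1,5) less_imp_le[OF LMI_o(2)] \<open>0 \<le> (\<nu>y - \<mu>y) / 2\<close> sector_y]])
  qed (use LMI_c(3) LMI_o(3,4) \<open>0 \<le> c\<close> in simp_all)
qed

end
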